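(* For every $f:\mathcal X\times\mathcal Y\to\mathcal Z$ with $k=\lceil\log|\mathcal Z|\rceil$, every $\lambda\in[0,1]$ and every $\epsilon>0$: $$R^{\mathrm{uni}}_\epsilon(f)\le R^{\mathrm{loc}}_\epsilon(f)\le R^{\mathrm{op}}_\epsilon(f)\le R^{\mathrm{uni}}_\epsilon(f)+k,$$ $$D^{\mathrm{loc}}(f)\le D^{A}(f)+D^{B}(f),\qquad R^{\mathrm{loc}}_\epsilon(f)\le R^{A}_{\lambda\epsilon}(f)+R^{B}_{(1-\lambda)\epsilon}(f),$$ and $$D^{\mathrm{uni}}(\mathrm{id}^A_n)=D^{A}(\mathrm{id}^A_n)=D^{B}(\mathrm{id}^B_n)=0,\qquad R^{\mathrm{loc}}_{1/4}(\mathrm{id}^A_n)=R^{\mathrm{loc}}_{1/4}(\mathrm{id}^B_n)\in\Omega(n).$$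
   Context: $\mathrm{id}^A_n,\mathrm{id}^B_n:\{0,1\}^n\times\{0,1\}^n\to\{0,1\}^n$ are $\mathrm{id}^A_n(x,y)=x$ and $\mathrm{id}^B_n(x,y)=y$. Two-party communication: Alice receives $x$, Bob $y$; private randomness $r_A,r_B$ and public randomness $r$; transcript $t_\pi$ = exchanged bits (public randomness excluded); cost = maximum number of bits exchanged. Output models with error $\epsilon$ (probability of correctness at least $1-\epsilon$ for every input): open — a map $O(t_\pi,r)$ equals $f(x,y)$; local — maps $O_A(t_\pi,r,r_A,x)$ and $O_B(t_\pi,r,r_B,y)$ both equal $f(x,y)$; Alice model — $O_A(t_\pi,r,r_A,x)=f(x,y)$; Bob model — $O_B(t_\pi,r,r_B,y)=f(x,y)$. $R^{\mathrm{op}}_\epsilon,R^{\mathrm{loc}}_\epsilon,R^{A}_\epsilon,R^{B}_\epsilon$ are the corresponding minimum costs (public and private coins allowed), $R^{\mathrm{uni}}_\epsilon=\min(R^A_\epsilon,R^B_\epsilon)$, and $D^{\mathcal M}=R^{\mathcal M}_0$ denotes the zero-error (deterministic) cost in model $\mathcal M$. Logarithms are base 2. *)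

theory Defs
  imports "HOL-Probability.Probability" "HOL-Library.Extended_Nat" "HOL-Library.Landau_Symbols"
begin

text \<open>
  A protocol tree for one fixed value of the public randomness. The owner of a node sends one
  bit, computed from her or his input and private randomness; dependence on the bits exchanged
  so far is the position in the tree.
\<close>

datatype ('x, 'y) ptree =
    Halt
  | Alice "'x \<Rightarrow> nat \<Rightarrow> bool" "bool \<Rightarrow> ('x, 'y) ptree"
  | Bob "'y \<Rightarrow> nat \<Rightarrow> bool" "bool \<Rightarrow> ('x, 'y) ptree"

primrec run :: "('x, 'y) ptree \<Rightarrow> 'x \<Rightarrow> 'y \<Rightarrow> nat \<Rightarrow> nat \<Rightarrow> bool list" where
  "run Halt x y rA rB = []"
| "run (Alice m c) x y rA rB = m x rA # run (c (m x rA)) x y rA rB"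
| "run (Bob m c) x y rA rB = m y rB # run (c (m y rB)) x y rA rB"

text \<open>
  Random strings are encoded as natural numbers with arbitrary discrete distributions. The whole
  tree, including who speaks when, may depend on the public randomness.
\<close>

record ('x, 'y) protocol =
  pub :: "nat pmf"
  privA :: "nat pmf"
  privB :: "nat pmf"
  tree :: "nat \<Rightarrow> ('x, 'y) ptree"

definition coins :: "('x, 'y) protocol \<Rightarrow> (nat \<times> nat \<times> nat) pmf" where
  "coins P = pair_pmf (pub P) (pair_pmf (privA P) (privB P))"

definition transcript ::
  "('x, 'y) protocol \<Rightarrow> 'x \<Rightarrow> 'y \<Rightarrow> nat \<Rightarrow> nat \<Rightarrow> nat \<Rightarrow> bool list" where
  "transcript P x y r rA rB = run (tree P r) x y rA rB"

definition cost :: "'x set \<Rightarrow> 'y set \<Rightarrow> ('x, 'y) protocol \<Rightarrow> enat" where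
  "cost X Y P =
    (SUP (x, y) \<in> X \<times> Y. SUP (r, rA, rB) \<in> set_pmf (coins P).
       enat (length (transcript P x y r rA rB)))"

definition computes_op ::
  "real \<Rightarrow> 'x set \<Rightarrow> 'y set \<Rightarrow> ('x \<times> 'y \<Rightarrow> 'z) \<Rightarrow> ('x, 'y) protocol \<Rightarrow> bool" where
  "computes_op \<epsilon> X Y f P \<longleftrightarrow>
    (\<exists>Out :: bool list \<Rightarrow> nat \<Rightarrow> 'z. \<forall>x\<in>X. \<forall>y\<in>Y.
       measure_pmf.prob (coins P)
         {(r, rA, rB). Out (transcript P x y r rA rB) r = f (x, y)} \<ge> 1 - \<epsilon>)"

definition computes_loc ::
  "real \<Rightarrow> 'x set \<Rightarrow> 'y set \<Rightarrow> ('x \<times> 'y \<Rightarrow> 'z) \<Rightarrow> ('x, 'y) protocol \<Rightarrow> bool" where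
  "computes_loc \<epsilon> X Y f P \<longleftrightarrow>
    (\<exists>(OutA :: bool list \<Rightarrow> nat \<Rightarrow> nat \<Rightarrow> 'x \<Rightarrow> 'z) (OutB :: bool list \<Rightarrow> nat \<Rightarrow> nat \<Rightarrow> 'y \<Rightarrow> 'z).
       \<forall>x\<in>X. \<forall>y\<in>Y.
       measure_pmf.prob (coins P)
         {(r, rA, rB). OutA (transcript P x y r rA rB) r rA x = f (x, y) \<and>
                       OutB (transcript P x y r rA rB) r rB y = f (x, y)} \<ge> 1 - \<epsilon>)"

definition computes_A ::
  "real \<Rightarrow> 'x set \<Rightarrow> 'y set \<Rightarrow> ('x \<times> 'y \<Rightarrow> 'z) \<Rightarrow> ('x, 'y) protocol \<Rightarrow> bool" where
  "computes_A \<epsilon> X Y f P \<longleftrightarrow>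
    (\<exists>OutA :: bool list \<Rightarrow> nat \<Rightarrow> nat \<Rightarrow> 'x \<Rightarrow> 'z. \<forall>x\<in>X. \<forall>y\<in>Y.
       measure_pmf.prob (coins P)
         {(r, rA, rB). OutA (transcript P x y r rA rB) r rA x = f (x, y)} \<ge> 1 - \<epsilon>)"

definition computes_B ::
  "real \<Rightarrow> 'x set \<Rightarrow> 'y set \<Rightarrow> ('x \<times> 'y \<Rightarrow> 'z) \<Rightarrow> ('x, 'y) protocol \<Rightarrow> bool" where
  "computes_B \<epsilon> X Y f P \<longleftrightarrow>
    (\<exists>OutB :: bool list \<Rightarrow> nat \<Rightarrow> nat \<Rightarrow> 'y \<Rightarrow> 'z. \<forall>x\<in>X. \<forall>y\<in>Y.
       measure_pmf.prob (coins P)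
         {(r, rA, rB). OutB (transcript P x y r rA rB) r rB y = f (x, y)} \<ge> 1 - \<epsilon>)"

text \<open>
  The infimum in \<^typ>\<open>enat\<close> is a minimum whenever some protocol computes the function, in
  particular for all finite \<open>X\<close> and \<open>Y\<close>; otherwise it is \<open>\<infinity>\<close>.
\<close>

definition R_op :: "real \<Rightarrow> 'x set \<Rightarrow> 'y set \<Rightarrow> ('x \<times> 'y \<Rightarrow> 'z) \<Rightarrow> enat" where
  "R_op \<epsilon> X Y f = (INF P \<in> {P. computes_op \<epsilon> X Y f P}. cost X Y P)"

definition R_loc :: "real \<Rightarrow> 'x set \<Rightarrow> 'y set \<Rightarrow> ('x \<times> 'y \<Rightarrow> 'z) \<Rightarrow> enat" where
  "R_loc \<epsilon> X Y f = (INF P \<in> {P. computes_loc \<epsilon> X Y f P}. cost X Y P)"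

definition R_A :: "real \<Rightarrow> 'x set \<Rightarrow> 'y set \<Rightarrow> ('x \<times> 'y \<Rightarrow> 'z) \<Rightarrow> enat" where
  "R_A \<epsilon> X Y f = (INF P \<in> {P. computes_A \<epsilon> X Y f P}. cost X Y P)"

definition R_B :: "real \<Rightarrow> 'x set \<Rightarrow> 'y set \<Rightarrow> ('x \<times> 'y \<Rightarrow> 'z) \<Rightarrow> enat" where
  "R_B \<epsilon> X Y f = (INF P \<in> {P. computes_B \<epsilon> X Y f P}. cost X Y P)"

definition R_uni :: "real \<Rightarrow> 'x set \<Rightarrow> 'y set \<Rightarrow> ('x \<times> 'y \<Rightarrow> 'z) \<Rightarrow> enat" where
  "R_uni \<epsilon> X Y f = min (R_A \<epsilon> X Y f) (R_B \<epsilon> X Y f)"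

definition D_loc :: "'x set \<Rightarrow> 'y set \<Rightarrow> ('x \<times> 'y \<Rightarrow> 'z) \<Rightarrow> enat" where
  "D_loc X Y f = R_loc 0 X Y f"

definition D_A :: "'x set \<Rightarrow> 'y set \<Rightarrow> ('x \<times> 'y \<Rightarrow> 'z) \<Rightarrow> enat" where
  "D_A X Y f = R_A 0 X Y f"

definition D_B :: "'x set \<Rightarrow> 'y set \<Rightarrow> ('x \<times> 'y \<Rightarrow> 'z) \<Rightarrow> enat" where
  "D_B X Y f = R_B 0 X Y f"

definition D_uni :: "'x set \<Rightarrow> 'y set \<Rightarrow> ('x \<times> 'y \<Rightarrow> 'z) \<Rightarrow> enat" where
  "D_uni X Y f = R_uni 0 X Y f"

definition cube :: "nat \<Rightarrow> bool list set" where
  "cube n = {w. length w = n}"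

text \<open>The dependence on \<open>n\<close> lies only in the domain \<open>cube n \<times> cube n\<close>.\<close>

definition id_A :: "bool list \<times> bool list \<Rightarrow> bool list" where
  "id_A = (\<lambda>(x, y). x)"

definition id_B :: "bool list \<times> bool list \<Rightarrow> bool list" where
  "id_B = (\<lambda>(x, y). y)"

end

(*
  One-sided protocols are turned into open ones by letting the informed player announce the answer
  at the end, and the two one-sided protocols are run one after the other, with independent
  randomness, to obtain a local one. For the lower bound, fix Bob's input and all coins: Bob can
  then be right on at most one x per transcript, so a protocol with c bits is right on fewer than
  2^(c+1) values of x. Averaging over the coins gives 3/4 * 2^n <= 2^(c+1).
*)
theory Submission
  imports Defs
begin

section \<open>Costs, attained minima, and inclusions between the output models\<close>

lemma length_transcript_le_cost:
  assumes "x \<in> X" "y \<in> Y" "(r, a, b) \<in> set_pmf (coins P)"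
  shows "enat (length (transcript P x y r a b)) \<le> cost X Y P"
  unfolding cost_def using assms by (force intro!: SUP_upper2)

lemma cost_leI:
  assumes "\<And>x y r a b. x \<in> X \<Longrightarrow> y \<in> Y \<Longrightarrow> (r, a, b) \<in> set_pmf (coins P) \<Longrightarrow>
    enat (length (transcript P x y r a b)) \<le> c"
  shows "cost X Y P \<le> c"
  unfolding cost_def using assms by (auto intro!: SUP_least)

text \<open>\<open>enat\<close> is well-ordered, so a nonempty infimum is a least element. This
  allows an optimal protocol to be picked instead of an approximating sequence.\<close>

lemma INF_enat_attained:
  fixes g :: "'a \<Rightarrow> enat"
  assumes "S \<noteq> {}"
  obtains P where "P \<in> S" "(INF P\<in>S. g P) = g P"
proof -
  have "Inf (g ` S) \<in> g ` S"
    using assms by (auto simp: Inf_enat_def intro: LeastI)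
  then show ?thesis using that by auto
qed

lemma prob_mono_ge:
  assumes "measure_pmf.prob M A \<ge> c" "A \<subseteq> B"
  shows "measure_pmf.prob M B \<ge> c"
  using assms(1) measure_pmf.finite_measure_mono[OF assms(2), of M] by simp

lemma computes_loc_imp_A:
  assumes "computes_loc \<epsilon> X Y f P" shows "computes_A \<epsilon> X Y f P"
proof -
  obtain OutA OutB where Out: "\<And>x y. x \<in> X \<Longrightarrow> y \<in> Y \<Longrightarrow> measure_pmf.prob (coins P)
      {(r, a, b). OutA (transcript P x y r a b) r a x = f (x, y) \<and>
        OutB (transcript P x y r a b) r b y = f (x, y)} \<ge> 1 - \<epsilon>"
    using assms unfolding computes_loc_def by blast
  show ?thesis unfolding computes_A_def
    by (intro exI[of _ OutA] ballI prob_mono_ge[OF Out]) auto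
qed

lemma computes_op_imp_loc:
  assumes "computes_op \<epsilon> X Y f P" shows "computes_loc \<epsilon> X Y f P"
proof -
  obtain Out where "\<forall>x\<in>X. \<forall>y\<in>Y. measure_pmf.prob (coins P)
      {(r, a, b). Out (transcript P x y r a b) r = f (x, y)} \<ge> 1 - \<epsilon>"
    using assms unfolding computes_op_def by blast
  then show ?thesis unfolding computes_loc_def
    by (intro exI[of _ "\<lambda>t r _ _. Out t r"]) simp
qed

lemma R_A_le_R_loc: "R_A \<epsilon> X Y f \<le> R_loc \<epsilon> X Y f"
  unfolding R_A_def R_loc_def by (rule INF_superset_mono) (auto dest: computes_loc_imp_A)

lemma R_loc_le_R_op: "R_loc \<epsilon> X Y f \<le> R_op \<epsilon> X Y f"
  unfolding R_op_def R_loc_def by (rule INF_superset_mono) (auto dest: computes_op_imp_loc)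


subsection \<open>Exchanging the players\<close>

text \<open>Exchanging the two roles turns statements about Bob into statements about Alice, so that
  the announcement argument is carried out for Alice alone.\<close>

primrec mirror :: "('x, 'y) ptree \<Rightarrow> ('y, 'x) ptree" where
  "mirror Halt = Halt"
| "mirror (Alice m c) = Bob m (\<lambda>b. mirror (c b))"
| "mirror (Bob m c) = Alice m (\<lambda>b. mirror (c b))"

lemma run_mirror [simp]: "run (mirror T) y x b a = run T x y a b"
  by (induction T) auto

definition flip_protocol :: "('x, 'y) protocol \<Rightarrow> ('y, 'x) protocol" where
  "flip_protocol P =
    \<lparr>pub = pub P, privA = privB P, privB = privA P, tree = (\<lambda>r. mirror (tree P r))\<rparr>"

lemma transcript_flip [simp]: "transcript (flip_protocol P) y x r b a = transcript P x y r a b"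
  by (simp add: transcript_def flip_protocol_def)

lemma coins_flip: "coins (flip_protocol P) = map_pmf (\<lambda>(r, a, b). (r, b, a)) (coins P)"
proof -
  have "map_pmf (\<lambda>(r, a, b). (r, b, a)) (coins P) =
      map_pmf (map_prod id prod.swap) (pair_pmf (pub P) (pair_pmf (privA P) (privB P)))"
    unfolding coins_def by (rule map_pmf_cong) auto
  also have "\<dots> = pair_pmf (pub P) (map_pmf prod.swap (pair_pmf (privA P) (privB P)))"
    by (simp add: pair_map_pmf2 apsnd_def)
  also have "map_pmf prod.swap (pair_pmf (privA P) (privB P)) = pair_pmf (privB P) (privA P)"
    by (subst pair_commute_pmf) (auto simp: prod.swap_def case_prod_unfold pmf.map_comp o_def)
  finally show ?thesis by (simp add: coins_def flip_protocol_def)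
qed

text \<open>Keeping the predicate \<open>Q\<close> arbitrary lets one equation transport the success
  events of all output models.\<close>

lemma prob_flip:
  "measure_pmf.prob (coins (flip_protocol P)) {(r, b, a). Q r b a} =
    measure_pmf.prob (coins P) {(r, a, b). Q r b a}"
  by (auto simp: coins_flip intro!: arg_cong[where f = "measure_pmf.prob (coins P)"])

lemma cost_flip: "cost Y X (flip_protocol P) \<le> cost X Y P"
  by (rule cost_leI) (auto simp: coins_flip intro!: length_transcript_le_cost)

lemma computes_loc_flip:
  assumes "computes_loc \<epsilon> X Y f P"
  shows "computes_loc \<epsilon> Y X (f \<circ> prod.swap) (flip_protocol P)"
  using assms unfolding computes_loc_def prob_flip by (fastforce simp: conj_commute)

lemma computes_B_flip:
  assumes "computes_B \<epsilon> X Y f P"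
  shows "computes_A \<epsilon> Y X (f \<circ> prod.swap) (flip_protocol P)"
  using assms unfolding computes_A_def computes_B_def prob_flip by fastforce

lemma computes_op_flip:
  assumes "computes_op \<epsilon> X Y f P"
  shows "computes_op \<epsilon> Y X (f \<circ> prod.swap) (flip_protocol P)"
  using assms unfolding computes_op_def prob_flip by fastforce

text \<open>One direction suffices: swapping is an involution, so the converse is the same
  inequality for the swapped function.\<close>

lemma R_loc_flip: "R_loc \<epsilon> Y X (f \<circ> prod.swap) \<le> R_loc \<epsilon> X Y f"
  unfolding R_loc_def by (rule INF_mono) (use computes_loc_flip cost_flip in blast)

lemma R_A_flip: "R_A \<epsilon> Y X (f \<circ> prod.swap) \<le> R_B \<epsilon> X Y f"
  unfolding R_A_def R_B_def by (rule INF_mono) (use computes_B_flip cost_flip in blast)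

lemma R_op_flip: "R_op \<epsilon> Y X (f \<circ> prod.swap) \<le> R_op \<epsilon> X Y f"
  unfolding R_op_def by (rule INF_mono) (use computes_op_flip cost_flip in blast)


subsection \<open>Sequential composition\<close>

lemma finite_cube: "finite (cube n)" and card_cube: "card (cube n) = 2 ^ n"
proof -
  have "cube n = {w. set w \<subseteq> UNIV \<and> length w = n}" by (simp add: cube_def)
  then show "finite (cube n)" "card (cube n) = 2 ^ n"
    using finite_lists_length_eq[of "UNIV :: bool set" n]
      card_lists_length_eq[of "UNIV :: bool set" n] by simp_all
qed

text \<open>The continuation receives the whole transcript of the first phase, which both players
  know. Passing \<open>\<lambda>t. g (b # t)\<close> downwards puts back the bits already
  sent.\<close>

primrec graft :: "('x, 'y) ptree \<Rightarrow> (bool list \<Rightarrow> ('x, 'y) ptree) \<Rightarrow> ('x, 'y) ptree" where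
  "graft Halt g = g []"
| "graft (Alice m c) g = Alice m (\<lambda>b. graft (c b) (\<lambda>t. g (b # t)))"
| "graft (Bob m c) g = Bob m (\<lambda>b. graft (c b) (\<lambda>t. g (b # t)))"

lemma run_graft:
  "run (graft T g) x y a b = run T x y a b @ run (g (run T x y a b)) x y a b"
  by (induction T arbitrary: g) auto

primrec tell :: "('x \<Rightarrow> nat \<Rightarrow> bool) list \<Rightarrow> ('x, 'y) ptree" where
  "tell [] = Halt"
| "tell (m # ms) = Alice m (\<lambda>_. tell ms)"

lemma run_tell: "run (tell ms) x y a b = map (\<lambda>m. m x a) ms"
  by (induction ms) auto

text \<open>In a composed protocol each player has one seed coding a pair; \<open>s\<close> selects
  the component that this subtree reads.\<close>

primrec reseed :: "(nat \<Rightarrow> nat) \<Rightarrow> ('x, 'y) ptree \<Rightarrow> ('x, 'y) ptree" where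
  "reseed s Halt = Halt"
| "reseed s (Alice m c) = Alice (\<lambda>x a. m x (s a)) (\<lambda>b. reseed s (c b))"
| "reseed s (Bob m c) = Bob (\<lambda>y a. m y (s a)) (\<lambda>b. reseed s (c b))"

lemma run_reseed [simp]: "run (reseed s T) x y a b = run T x y (s a) (s b)"
  by (induction T) auto

text \<open>Transcripts of one tree are prefix-free, so they can be cut off without knowing the inputs.\<close>

primrec path_prefix :: "('x, 'y) ptree \<Rightarrow> bool list \<Rightarrow> bool list" where
  "path_prefix Halt t = []"
| "path_prefix (Alice m c) t = hd t # path_prefix (c (hd t)) (tl t)"
| "path_prefix (Bob m c) t = hd t # path_prefix (c (hd t)) (tl t)"

text \<open>The tree alone determines where its run stops, whatever follows. The unspecified
  \<open>hd []\<close> is never met, since a run supplies one bit at every inner node.\<close>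

lemma path_prefix_run [simp]: "path_prefix T (run T x y a b @ s) = run T x y a b"
  by (induction T) auto

section \<open>From one-sided to open protocols by announcing the answer\<close>

lemma R_op_le_R_A:
  fixes f :: "'x \<times> 'y \<Rightarrow> 'z"
  assumes "finite Z" "f \<in> X \<times> Y \<rightarrow> Z" "card Z \<le> 2 ^ k"
  shows "R_op \<epsilon> X Y f \<le> R_A \<epsilon> X Y f + enat k"
proof (cases "{P. computes_A \<epsilon> X Y f P} = {}")
  case True
  \<comment> \<open>Without any such protocol \<open>R_A\<close> is an empty infimum, hence
    infinite.\<close>
  then show ?thesis by (simp add: R_A_def top_enat_def)
next
  case False
  obtain P where P: "computes_A \<epsilon> X Y f P" "R_A \<epsilon> X Y f = cost X Y P"
    using INF_enat_attained[OF False, of "cost X Y"] unfolding R_A_def by auto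
  obtain OutA where OutA: "\<And>x y. x \<in> X \<Longrightarrow> y \<in> Y \<Longrightarrow> measure_pmf.prob (coins P)
      {(r, a, b). OutA (transcript P x y r a b) r a x = f (x, y)} \<ge> 1 - \<epsilon>"
    using P(1) unfolding computes_A_def by blast
  obtain enc :: "'z \<Rightarrow> bool list" where enc: "enc ` Z \<subseteq> cube k" "inj_on enc Z"
    using card_le_inj[of Z "cube k"] assms by (auto simp: finite_cube card_cube)
  \<comment> \<open>Indexing over \<open>[0..<k]\<close> makes Alice send exactly \<open>k\<close>
    bits even when her output is wrong and lies outside \<open>Z\<close>, where \<open>enc\<close>
    is unconstrained.\<close>
  define say :: "nat \<Rightarrow> bool list \<Rightarrow> ('x, 'y) ptree" where
    "say r t = tell (map (\<lambda>i x a. enc (OutA t r a x) ! i) [0..<k])" for r t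
  define Q where "Q = P\<lparr>tree := \<lambda>r. graft (tree P r) (say r)\<rparr>"
  have coins_Q: "coins Q = coins P" by (simp add: coins_def Q_def)
  have transcript_Q: "transcript Q x y r a b = transcript P x y r a b @
      map (\<lambda>i. enc (OutA (transcript P x y r a b) r a x) ! i) [0..<k]" for x y r a b
    by (simp add: transcript_def Q_def run_graft say_def run_tell o_def)
  have "computes_op \<epsilon> X Y f Q" unfolding computes_op_def
  \<comment> \<open>The announcement is the last \<open>k\<close> bits, so it can be cut off from
    the end although the length of the first phase varies.\<close>
  proof (intro exI[of _ "\<lambda>t _. the_inv_into Z enc (drop (length t - k) t)"] ballI)
    fix x y assume xy: "x \<in> X" "y \<in> Y"
    then have fZ: "f (x, y) \<in> Z" using assms by auto
    then have "length (enc (f (x, y))) = k" using enc(1) by (auto simp: cube_def)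
    then have "map (\<lambda>i. enc (f (x, y)) ! i) [0..<k] = enc (f (x, y))"
      using map_nth[of "enc (f (x, y))"] by metis
    then have "the_inv_into Z enc (map (\<lambda>i. enc (f (x, y)) ! i) [0..<k]) = f (x, y)"
      by (simp only: the_inv_into_f_f[OF enc(2) fZ])
    \<comment> \<open>Whenever Alice is right, the decoded announcement is right, so no new error
      arises.\<close>
    then have "{(r, a, b). OutA (transcript P x y r a b) r a x = f (x, y)} \<subseteq>
        {(r, a, b). the_inv_into Z enc (drop (length (transcript Q x y r a b) - k)
          (transcript Q x y r a b)) = f (x, y)}"
      by (auto simp: transcript_Q)
    then show "measure_pmf.prob (coins Q) {(r, a, b). the_inv_into Z enc
        (drop (length (transcript Q x y r a b) - k) (transcript Q x y r a b)) = f (x, y)} \<ge> 1 - \<epsilon>"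
      unfolding coins_Q by (rule prob_mono_ge[OF OutA[OF xy]])
  qed
  then have "R_op \<epsilon> X Y f \<le> cost X Y Q" unfolding R_op_def by (auto intro: INF_lower)
  also have "\<dots> \<le> cost X Y P + enat k"
    by (rule cost_leI)
      (auto simp: transcript_Q coins_Q simp flip: plus_enat_simps(1)
        intro!: add_right_mono length_transcript_le_cost)
  finally show ?thesis by (simp add: P(2))
qed

text \<open>Bob's case is Alice's case for the swapped function on \<open>Y \<times> X\<close>,
  carried back by a second swap.\<close>

lemma R_op_le_R_B:
  fixes f :: "'x \<times> 'y \<Rightarrow> 'z"
  assumes "finite Z" "f \<in> X \<times> Y \<rightarrow> Z" "card Z \<le> 2 ^ k"
  shows "R_op \<epsilon> X Y f \<le> R_B \<epsilon> X Y f + enat k"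
proof -
  have "R_op \<epsilon> X Y f \<le> R_op \<epsilon> Y X (f \<circ> prod.swap)"
    using R_op_flip[of \<epsilon> X Y "f \<circ> prod.swap"] by (simp add: comp_assoc)
  also have "\<dots> \<le> R_A \<epsilon> Y X (f \<circ> prod.swap) + enat k"
    using assms by (intro R_op_le_R_A[of Z]) auto
  also have "\<dots> \<le> R_B \<epsilon> X Y f + enat k"
    by (intro add_right_mono R_A_flip)
  finally show ?thesis .
qed

section \<open>Running two protocols one after the other\<close>

abbreviation fst_seed :: "nat \<Rightarrow> nat" where "fst_seed s \<equiv> fst (prod_decode s)"
abbreviation snd_seed :: "nat \<Rightarrow> nat" where "snd_seed s \<equiv> snd (prod_decode s)"

text \<open>Seeds are single natural numbers, so two independent seeds are packed by the pairing
  bijection.\<close>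

definition pair_seed :: "nat pmf \<Rightarrow> nat pmf \<Rightarrow> nat pmf" where
  "pair_seed p q = map_pmf prod_encode (pair_pmf p q)"

lemma map_pair_seed [simp]:
  "map_pmf fst_seed (pair_seed p q) = p" "map_pmf snd_seed (pair_seed p q) = q"
  by (simp_all add: pair_seed_def pmf.map_comp o_def map_fst_pair_pmf map_snd_pair_pmf)

definition then_protocol :: "('x, 'y) protocol \<Rightarrow> ('x, 'y) protocol \<Rightarrow> ('x, 'y) protocol" where
  "then_protocol P Q =
    \<lparr>pub = pair_seed (pub P) (pub Q), privA = pair_seed (privA P) (privA Q),
     privB = pair_seed (privB P) (privB Q),
     tree = (\<lambda>r. graft (reseed fst_seed (tree P (fst_seed r)))
       (\<lambda>_. reseed snd_seed (tree Q (snd_seed r))))\<rparr>"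

lemma transcript_then:
  "transcript (then_protocol P Q) x y r a b =
    transcript P x y (fst_seed r) (fst_seed a) (fst_seed b) @
    transcript Q x y (snd_seed r) (snd_seed a) (snd_seed b)"
  by (simp add: transcript_def then_protocol_def run_graft)

lemma map_pmf_triple:
  "map_pmf (\<lambda>(r, a, b). (g r, g a, g b)) (pair_pmf p (pair_pmf q s)) =
    pair_pmf (map_pmf g p) (pair_pmf (map_pmf g q) (map_pmf g s))"
  by (simp add: map_pair[symmetric] case_prod_unfold map_prod_def)

text \<open>Each projection of the joint coins has exactly the law of the component's coins.
  Supports and success probabilities of either run can thus be read off in its own protocol.\<close>

lemma coins_then:
  "map_pmf (\<lambda>(r, a, b). (fst_seed r, fst_seed a, fst_seed b)) (coins (then_protocol P Q)) = coins P"
  "map_pmf (\<lambda>(r, a, b). (snd_seed r, snd_seed a, snd_seed b)) (coins (then_protocol P Q)) = coins Q"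
  by (simp_all add: coins_def then_protocol_def map_pmf_triple)

lemma cost_then: "cost X Y (then_protocol P Q) \<le> cost X Y P + cost X Y Q"
proof (rule cost_leI)
  fix x y r a b
  assume xy: "x \<in> X" "y \<in> Y" and c: "(r, a, b) \<in> set_pmf (coins (then_protocol P Q))"
  have "(fst_seed r, fst_seed a, fst_seed b) \<in> set_pmf (coins P)"
    "(snd_seed r, snd_seed a, snd_seed b) \<in> set_pmf (coins Q)"
    using c by (subst coins_then[symmetric, of _ Q] coins_then[symmetric, of _ P], force)+
  then show "enat (length (transcript (then_protocol P Q) x y r a b)) \<le> cost X Y P + cost X Y Q"
    using xy by (auto simp: transcript_then simp flip: plus_enat_simps(1)
        intro!: add_mono length_transcript_le_cost)
qed

text \<open>The union bound for the two complements.\<close>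

lemma prob_conj_ge:
  assumes "measure_pmf.prob M A \<ge> 1 - \<alpha>" "measure_pmf.prob M B \<ge> 1 - \<beta>"
  shows "measure_pmf.prob M (A \<inter> B) \<ge> 1 - (\<alpha> + \<beta>)"
proof -
  have "measure_pmf.prob M (- (A \<inter> B)) \<le> measure_pmf.prob M (- A) + measure_pmf.prob M (- B)"
    unfolding Compl_Int by (rule measure_subadditive) (auto simp: measure_pmf.emeasure_eq_measure)
  then show ?thesis
    using assms measure_pmf.prob_compl[of _ M] by (simp add: Compl_eq_Diff_UNIV)
qed

text \<open>Alice answers from the first run and Bob from the second; the union bound adds their
  errors.\<close>

lemma computes_then:
  assumes "computes_A \<alpha> X Y f P" "computes_B \<beta> X Y f Q"
  shows "computes_loc (\<alpha> + \<beta>) X Y f (then_protocol P Q)"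
proof -
  obtain OutA where OutA: "\<And>x y. x \<in> X \<Longrightarrow> y \<in> Y \<Longrightarrow> measure_pmf.prob (coins P)
      {(r, a, b). OutA (transcript P x y r a b) r a x = f (x, y)} \<ge> 1 - \<alpha>"
    using assms(1) unfolding computes_A_def by blast
  obtain OutB where OutB: "\<And>x y. x \<in> X \<Longrightarrow> y \<in> Y \<Longrightarrow> measure_pmf.prob (coins Q)
      {(r, a, b). OutB (transcript Q x y r a b) r b y = f (x, y)} \<ge> 1 - \<beta>"
    using assms(2) unfolding computes_B_def by blast
  \<comment> \<open>The public seed reveals the tree of \<open>P\<close>, so both players can
    separate the two transcripts without any private information.\<close>
  define first where "first r t = path_prefix (tree P (fst_seed r)) t" for r t
  have first: "first r (transcript (then_protocol P Q) x y r a b) =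
      transcript P x y (fst_seed r) (fst_seed a) (fst_seed b)" for x y r a b
    unfolding first_def transcript_then by (simp add: transcript_def)
  define OA where "OA t r a x = OutA (first r t) (fst_seed r) (fst_seed a) x" for t r a x
  define OB where
    "OB t r b y = OutB (drop (length (first r t)) t) (snd_seed r) (snd_seed b) y" for t r b y
  show ?thesis unfolding computes_loc_def
  proof (intro exI[of _ OA] exI[of _ OB] ballI)
    fix x y assume xy: "x \<in> X" "y \<in> Y"
    let ?T = "transcript (then_protocol P Q) x y"
    let ?M = "coins (then_protocol P Q)"
    \<comment> \<open>Alice's success depends only on the first components of the seeds, so this
      event is the preimage of an event about \<open>P\<close> alone.\<close>
    have "measure_pmf.prob ?M {(r, a, b). OA (?T r a b) r a x = f (x, y)} \<ge> 1 - \<alpha>"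
      using OutA[OF xy]
      by (subst (asm) coins_then(1)[symmetric, of _ Q])
        (simp add: vimage_def case_prod_unfold OA_def first)
    moreover have "measure_pmf.prob ?M {(r, a, b). OB (?T r a b) r b y = f (x, y)} \<ge> 1 - \<beta>"
      using OutB[OF xy]
      by (subst (asm) coins_then(2)[symmetric, of _ P])
        (simp add: vimage_def case_prod_unfold OB_def first, simp add: transcript_then)
    ultimately have "measure_pmf.prob ?M ({(r, a, b). OA (?T r a b) r a x = f (x, y)} \<inter>
        {(r, a, b). OB (?T r a b) r b y = f (x, y)}) \<ge> 1 - (\<alpha> + \<beta>)"
      by (rule prob_conj_ge)
    also have "{(r, a, b). OA (?T r a b) r a x = f (x, y)} \<inter>
        {(r, a, b). OB (?T r a b) r b y = f (x, y)} =
        {(r, a, b). OA (?T r a b) r a x = f (x, y) \<and> OB (?T r a b) r b y = f (x, y)}"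
      by auto
    finally show "measure_pmf.prob ?M {(r, a, b). OA (?T r a b) r a x = f (x, y) \<and>
        OB (?T r a b) r b y = f (x, y)} \<ge> 1 - (\<alpha> + \<beta>)" .
  qed
qed

text \<open>Leaving both errors free covers the zero-error bound and the convex split of
  \<open>\<epsilon>\<close> at once.\<close>

lemma R_loc_le_sum: "R_loc (\<alpha> + \<beta>) X Y f \<le> R_A \<alpha> X Y f + R_B \<beta> X Y f"
proof (cases "{P. computes_A \<alpha> X Y f P} = {} \<or> {P. computes_B \<beta> X Y f P} = {}")
  case True
  then show ?thesis by (auto simp: R_A_def R_B_def top_enat_def)
next
  case False
  then have ne: "{P. computes_A \<alpha> X Y f P} \<noteq> {}" "{P. computes_B \<beta> X Y f P} \<noteq> {}" by auto
  obtain P where P: "computes_A \<alpha> X Y f P" "R_A \<alpha> X Y f = cost X Y P"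
    using INF_enat_attained[OF ne(1), of "cost X Y"] unfolding R_A_def by auto
  obtain Q where Q: "computes_B \<beta> X Y f Q" "R_B \<beta> X Y f = cost X Y Q"
    using INF_enat_attained[OF ne(2), of "cost X Y"] unfolding R_B_def by auto
  have "R_loc (\<alpha> + \<beta>) X Y f \<le> cost X Y (then_protocol P Q)"
    unfolding R_loc_def using computes_then[OF P(1) Q(1)] by (auto intro: INF_lower)
  also have "\<dots> \<le> cost X Y P + cost X Y Q" by (rule cost_then)
  finally show ?thesis by (simp add: P Q)
qed


subsection \<open>The identity functions\<close>

definition silent :: "('x, 'y) protocol" where
  "silent = \<lparr>pub = return_pmf 0, privA = return_pmf 0, privB = return_pmf 0, tree = (\<lambda>_. Halt)\<rparr>"

lemma cost_silent: "cost X Y silent = 0"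
proof -
  have "cost X Y silent \<le> 0"
    by (rule cost_leI) (simp add: silent_def transcript_def zero_enat_def)
  then show ?thesis by simp
qed

text \<open>Alice already holds the answer and outputs \<open>x\<close> with certainty.\<close>

lemma R_A_id_A: "\<epsilon> \<ge> 0 \<Longrightarrow> R_A \<epsilon> X Y id_A = 0"
proof -
  assume "\<epsilon> \<ge> 0"
  then have "computes_A \<epsilon> X Y id_A silent"
    unfolding computes_A_def by (intro exI[of _ "\<lambda>_ _ _ x. x"]) (simp add: id_A_def case_prod_unfold)
  then have "R_A \<epsilon> X Y id_A \<le> cost X Y silent"
    unfolding R_A_def by (auto intro: INF_lower)
  then show ?thesis by (simp add: cost_silent)
qed

lemma R_B_id_B: "\<epsilon> \<ge> 0 \<Longrightarrow> R_B \<epsilon> X Y id_B = 0"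
proof -
  assume "\<epsilon> \<ge> 0"
  then have "computes_B \<epsilon> X Y id_B silent"
    unfolding computes_B_def by (intro exI[of _ "\<lambda>_ _ _ y. y"]) (simp add: id_B_def case_prod_unfold)
  then have "R_B \<epsilon> X Y id_B \<le> cost X Y silent"
    unfolding R_B_def by (auto intro: INF_lower)
  then show ?thesis by (simp add: cost_silent)
qed

lemma id_swap: "id_A \<circ> prod.swap = id_B" "id_B \<circ> prod.swap = id_A"
  by (auto simp: id_A_def id_B_def)

text \<open>Alice announces her \<open>n\<close> bits. The bound guarantees finiteness, without
  which \<open>the_enat\<close> would say nothing about the cost.\<close>

lemma R_loc_id_A_le: "R_loc (1/4) (cube n) (cube n) id_A \<le> enat n"
proof -
  have "R_loc (1/4) (cube n) (cube n) id_A \<le> R_op (1/4) (cube n) (cube n) id_A"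
    by (rule R_loc_le_R_op)
  also have "\<dots> \<le> R_A (1/4) (cube n) (cube n) id_A + enat n"
    by (rule R_op_le_R_A[of "cube n"]) (auto simp: finite_cube card_cube id_A_def)
  finally show ?thesis by (simp add: R_A_id_A)
qed

section \<open>The linear lower bound by counting transcripts\<close>

lemma card_short_words:
  "finite {t :: bool list. length t \<le> c}" "card {t :: bool list. length t \<le> c} < 2 ^ (c + 1)"
proof -
  have eq: "{t :: bool list. length t \<le> c} = {t. set t \<subseteq> UNIV \<and> length t \<le> c}" by simp
  show "finite {t :: bool list. length t \<le> c}"
    unfolding eq by (rule finite_lists_length_le) simp
  \<comment> \<open>The cost only bounds lengths, so words of every length up to \<open>c\<close>
    are counted, \<open>2 ^ (c + 1) - 1\<close> in total.\<close>
  have "card {t :: bool list. length t \<le> c} = (\<Sum>i\<le>c. 2 ^ i)"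
    unfolding eq by (subst card_lists_length_le) simp_all
  also have "\<dots> < 2 ^ (c + 1)" by (induction c) auto
  finally show "card {t :: bool list. length t \<le> c} < 2 ^ (c + 1)" .
qed

text \<open>On the recovered inputs \<open>dec\<close> is a left inverse of \<open>enc\<close>, so
  \<open>enc\<close> embeds them into the short words.\<close>

lemma recovered_inputs_bound:
  fixes enc :: "'x \<Rightarrow> bool list"
  assumes "finite X" "\<And>x. x \<in> X \<Longrightarrow> length (enc x) \<le> c"
  shows "card {x \<in> X. dec (enc x) = x} \<le> 2 ^ (c + 1)"
proof -
  have "card {x \<in> X. dec (enc x) = x} \<le> card {t :: bool list. length t \<le> c}"
    using assms
    by (intro card_inj_on_le[of enc] card_short_words(1) inj_on_inverseI[of _ dec]) auto
  then show ?thesis using card_short_words(2)[of c] by simp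
qed

lemma loc_id_A_lower:
  assumes "computes_loc (1/4) (cube n) (cube n) id_A P" "cost (cube n) (cube n) P \<le> enat c"
  shows "n \<le> c + 2"
proof -
  obtain OutA OutB where Out: "\<And>x y. x \<in> cube n \<Longrightarrow> y \<in> cube n \<Longrightarrow> measure_pmf.prob (coins P)
      {(r, a, b). OutA (transcript P x y r a b) r a x = id_A (x, y) \<and>
        OutB (transcript P x y r a b) r b y = id_A (x, y)} \<ge> 1 - 1/4"
    using assms(1) unfolding computes_loc_def by blast
  \<comment> \<open>Any fixed input of Bob works, because \<open>id_A\<close> ignores it.\<close>
  define y where "y = replicate n False"
  have y: "y \<in> cube n" by (simp add: y_def cube_def)
  define E where "E x = {(r, a, b). OutB (transcript P x y r a b) r b y = x}" for x
  have prob_E: "measure_pmf.prob (coins P) (E x) \<ge> 3/4" if "x \<in> cube n" for x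
  proof -
    have "3/4 \<le> measure_pmf.prob (coins P)
      {(r, a, b). OutA (transcript P x y r a b) r a x = id_A (x, y) \<and>
        OutB (transcript P x y r a b) r b y = id_A (x, y)}"
      using Out[OF that y] by simp
    also have "\<dots> \<le> measure_pmf.prob (coins P) (E x)"
      by (rule measure_pmf.finite_measure_mono) (auto simp: E_def id_A_def)
    finally show ?thesis .
  qed
  \<comment> \<open>For fixed coins and \<open>y\<close>, Bob decodes \<open>x\<close> from the
    transcript alone: the transcript is the code word and \<open>OutB\<close> the decoder.\<close>
  have correct: "(\<Sum>x\<in>cube n. indicat_real (E x) w) \<le> 2 ^ (c + 1)" if w: "w \<in> set_pmf (coins P)" for w
  proof -
    obtain r a b where rab: "w = (r, a, b)" by (cases w)
    have len: "length (transcript P x y r a b) \<le> c" if "x \<in> cube n" for x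
      using length_transcript_le_cost[OF that y, of r a b P] w assms(2) unfolding rab
      by (meson enat_ord_simps(1) order_trans)
    have "(\<Sum>x\<in>cube n. indicat_real (E x) w) = real (card {x \<in> cube n. w \<in> E x})"
      using finite_cube[of n] by (simp add: indicator_def sum.If_cases Int_def)
    also have "{x \<in> cube n. w \<in> E x} =
        {x \<in> cube n. (\<lambda>t. OutB t r b y) (transcript P x y r a b) = x}"
      by (simp add: E_def rab)
    also have "card \<dots> \<le> 2 ^ (c + 1)"
      by (rule recovered_inputs_bound) (auto simp: finite_cube len)
    finally show ?thesis by (simp add: numeral_power_le_of_nat_cancel_iff)
  qed
  have "3/4 * 2 ^ n = (\<Sum>x\<in>cube n. 3/4 :: real)"
    by (simp add: card_cube)
  also have "\<dots> \<le> (\<Sum>x\<in>cube n. measure_pmf.prob (coins P) (E x))"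
    by (intro sum_mono prob_E)
  \<comment> \<open>Linearity of expectation: the sum of probabilities is the mean number of inputs
    on which Bob is right.\<close>
  also have "\<dots> = measure_pmf.expectation (coins P) (\<lambda>w. \<Sum>x\<in>cube n. indicat_real (E x) w)"
    by (subst Bochner_Integration.integral_sum) (auto simp: measure_pmf.emeasure_eq_measure)
  also have "\<dots> \<le> measure_pmf.expectation (coins P) (\<lambda>_. 2 ^ (c + 1))"
    by (intro integral_mono_AE) (use correct in \<open>auto simp: AE_measure_pmf_iff measure_pmf.emeasure_eq_measure\<close>)
  finally have "3 * 2 ^ n \<le> (2 :: real) ^ (c + 3)"
    by (simp add: field_simps power_add)
  \<comment> \<open>Replacing the factor 3 by 2 leaves pure powers, and comparing exponents gives
    \<open>n + 1 < c + 3\<close>.\<close>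
  moreover have "(2 :: real) ^ (n + 1) < 3 * 2 ^ n" by simp
  ultimately have "(2 :: real) ^ (n + 1) < 2 ^ (c + 3)" by linarith
  then show ?thesis by (simp only: power_strict_increasing_iff)
qed

lemma R_loc_id_A_ge: "n \<le> the_enat (R_loc (1/4) (cube n) (cube n) id_A) + 2"
proof -
  obtain c where c: "R_loc (1/4) (cube n) (cube n) id_A = enat c"
    using R_loc_id_A_le[of n] by (cases "R_loc (1/4) (cube n) (cube n) id_A") auto
  then have ne: "{P. computes_loc (1/4) (cube n) (cube n) id_A P} \<noteq> {}"
    by (auto simp: R_loc_def top_enat_def simp del: Collect_empty_eq)
  then obtain P where "computes_loc (1/4) (cube n) (cube n) id_A P"
    "R_loc (1/4) (cube n) (cube n) id_A = cost (cube n) (cube n) P"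
    using INF_enat_attained[OF ne, of "cost (cube n) (cube n)"] unfolding R_loc_def by auto
  then show ?thesis using loc_id_A_lower[of n P c] unfolding c by (metis order_refl the_enat.simps)
qed

section \<open>The rounded logarithm and the assembly of all claims\<close>

lemma card_le_two_power:
  assumes "int k = \<lceil>log 2 (real N)\<rceil>"
  shows "N \<le> 2 ^ k"
\<comment> \<open>At zero the logarithm is only a default value, but there the bound is
  trivial.\<close>
proof (cases "N = 0")
  case False
  have "log 2 (real N) \<le> real k" using assms by linarith
  then have "real N \<le> 2 powr real k" using False by (simp add: log_le_iff)
  then have "real N \<le> real (2 ^ k)" by (simp add: powr_realpow)
  then show ?thesis by (simp only: of_nat_le_iff)
qed simp

theorem mainTheorem9:
  "(\<forall>(X :: 'x set) (Y :: 'y set) (Z :: 'z set) (f :: 'x \<times> 'y \<Rightarrow> 'z) (k :: nat) (l :: real) (\<epsilon> :: real).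
      finite Z \<and> f \<in> X \<times> Y \<rightarrow> Z \<and> int k = \<lceil>log 2 (real (card Z))\<rceil> \<and>
      0 \<le> l \<and> l \<le> 1 \<and> \<epsilon> > 0 \<longrightarrow>
        R_uni \<epsilon> X Y f \<le> R_loc \<epsilon> X Y f \<and>
        R_loc \<epsilon> X Y f \<le> R_op \<epsilon> X Y f \<and>
        R_op \<epsilon> X Y f \<le> R_uni \<epsilon> X Y f + enat k \<and>
        D_loc X Y f \<le> D_A X Y f + D_B X Y f \<and>
        R_loc \<epsilon> X Y f \<le> R_A (l * \<epsilon>) X Y f + R_B ((1 - l) * \<epsilon>) X Y f) \<and>
   (\<forall>n. D_uni (cube n) (cube n) id_A = 0 \<and>
        D_A (cube n) (cube n) id_A = 0 \<and>
        D_B (cube n) (cube n) id_B = 0 \<and>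
        R_loc (1/4) (cube n) (cube n) id_A = R_loc (1/4) (cube n) (cube n) id_B) \<and>
   (\<lambda>n. real (the_enat (R_loc (1/4) (cube n) (cube n) id_A))) \<in> \<Omega>(\<lambda>n. real n)"
proof (intro conjI allI impI)
  fix X :: "'x set" and Y :: "'y set" and Z :: "'z set" and f :: "'x \<times> 'y \<Rightarrow> 'z"
    and k :: nat and l \<epsilon> :: real
  assume *: "finite Z \<and> f \<in> X \<times> Y \<rightarrow> Z \<and> int k = \<lceil>log 2 (real (card Z))\<rceil> \<and>
      0 \<le> l \<and> l \<le> 1 \<and> \<epsilon> > 0"
  then have "card Z \<le> 2 ^ k" using card_le_two_power by blast
  with * show "R_op \<epsilon> X Y f \<le> R_uni \<epsilon> X Y f + enat k"
    using R_op_le_R_A[of Z f X Y k \<epsilon>] R_op_le_R_B[of Z f X Y k \<epsilon>] by (simp add: R_uni_def min_def)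
  show "R_uni \<epsilon> X Y f \<le> R_loc \<epsilon> X Y f"
    unfolding R_uni_def by (rule min.coboundedI1) (rule R_A_le_R_loc)
  show "R_loc \<epsilon> X Y f \<le> R_op \<epsilon> X Y f" by (rule R_loc_le_R_op)
  show "D_loc X Y f \<le> D_A X Y f + D_B X Y f"
    using R_loc_le_sum[of 0 0 X Y f] by (simp add: D_loc_def D_A_def D_B_def)
  show "R_loc \<epsilon> X Y f \<le> R_A (l * \<epsilon>) X Y f + R_B ((1 - l) * \<epsilon>) X Y f"
    using R_loc_le_sum[of "l * \<epsilon>" "(1 - l) * \<epsilon>" X Y f] by (simp add: algebra_simps)
next
  fix n
  show "D_A (cube n) (cube n) id_A = 0" by (simp add: D_A_def R_A_id_A)
  show "D_uni (cube n) (cube n) id_A = 0" by (simp add: D_uni_def R_uni_def R_A_id_A)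
  show "D_B (cube n) (cube n) id_B = 0" by (simp add: D_B_def R_B_id_B)
  show "R_loc (1/4) (cube n) (cube n) id_A = R_loc (1/4) (cube n) (cube n) id_B"
    \<comment> \<open>The two identities are swaps of each other, so the two instances give both
      inequalities.\<close>
    using R_loc_flip[of "1/4" "cube n" "cube n" id_A] R_loc_flip[of "1/4" "cube n" "cube n" id_B]
    by (simp add: id_swap)
next
  \<comment> \<open>Writing \<open>C\<close> for the cost, \<open>n \<le> C + 2\<close> gives
    \<open>n \<le> 2 * (n - 2) \<le> 2 * C\<close> as soon as \<open>n \<ge> 4\<close>; hence the
    factor 2 and the threshold 4.\<close>
  have "eventually (\<lambda>n. norm (real n) \<le>
      2 * norm (real (the_enat (R_loc (1/4) (cube n) (cube n) id_A)))) at_top"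
    using eventually_ge_at_top[of 4]
  proof eventually_elim
    case (elim n)
    then show ?case using R_loc_id_A_ge[of n] by simp
  qed
  then show "(\<lambda>n. real (the_enat (R_loc (1/4) (cube n) (cube n) id_A))) \<in> \<Omega>(\<lambda>n. real n)"
    by (subst bigomega_iff_bigo) (rule landau_o.bigI[of 2], simp)
qed

end
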